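(* Let $\mathcal{A}$ be a supersolvable line arrangement in the complex projective plane $\mathbb{P}^2$. Let $p$ be a modular point of $\mathcal{A}$ with maximal multiplicity $m\ge 2$. Then $d:=|\mathcal{A}|\le 3m-3$.
   Context: A line arrangement $\mathcal{A}$ in $\mathbb{P}^2$ is a finite set of distinct lines; $|\mathcal{A}|$ is the number of lines. An intersection point of $\mathcal{A}$ is a point lying on at least two lines of $\mathcal{A}$, and its multiplicity is the number of lines of $\mathcal{A}$ passing through it. An intersection point $p$ is called modular if for every other intersection point $q$ of $\mathcal{A}$ the line $\overline{pq}$ belongs to $\mathcal{A}$. The arrangement is supersolvable if it has a modular intersection point. "Maximal multiplicity" means maximal among the multiplicities of the modular points of $\mathcal{A}$. *)

theory Defs
  imports "HOL-Analysis.Analysis"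
begin

text \<open>
  Points and lines of the complex projective plane are the one- and two-dimensional complex
  linear subspaces of \<open>\<complex>\<^sup>3\<close>, with inclusion as incidence. The prefix \<open>vec\<close> selects the linear
  algebra over the scalar field \<open>complex\<close>; the unprefixed \<open>subspace\<close>, \<open>span\<close> and \<open>dim\<close> are
  over the reals.
\<close>

definition proj_points :: "(complex ^ 3) set set" where
  "proj_points = {p. vec.subspace p \<and> vec.dim p = 1}"

definition proj_lines :: "(complex ^ 3) set set" where
  "proj_lines = {L. vec.subspace L \<and> vec.dim L = 2}"

definition line_through :: "(complex ^ 3) set \<Rightarrow> (complex ^ 3) set \<Rightarrow> (complex ^ 3) set" where
  "line_through p q = vec.span (p \<union> q)"

definition line_arrangement :: "(complex ^ 3) set set \<Rightarrow> bool" where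
  "line_arrangement \<A> \<longleftrightarrow> finite \<A> \<and> \<A> \<subseteq> proj_lines"

definition multiplicity_at :: "(complex ^ 3) set set \<Rightarrow> (complex ^ 3) set \<Rightarrow> nat" where
  "multiplicity_at \<A> p = card {L \<in> \<A>. p \<subseteq> L}"

definition intersection_points :: "(complex ^ 3) set set \<Rightarrow> (complex ^ 3) set set" where
  "intersection_points \<A> = {p \<in> proj_points. multiplicity_at \<A> p \<ge> 2}"

definition modular_point :: "(complex ^ 3) set set \<Rightarrow> (complex ^ 3) set \<Rightarrow> bool" where
  "modular_point \<A> p \<longleftrightarrow> p \<in> intersection_points \<A> \<and>
     (\<forall>q \<in> intersection_points \<A>. q \<noteq> p \<longrightarrow> line_through p q \<in> \<A>)"

definition supersolvable :: "(complex ^ 3) set set \<Rightarrow> bool" where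
  "supersolvable \<A> \<longleftrightarrow> (\<exists>p. modular_point \<A> p)"

end

theory Submission
  imports Defs
begin

text \<open>
  Put \<open>p\<close> at infinity in the vertical direction and a line of \<open>\<A>\<close> through \<open>p\<close> at infinity. The
  other \<open>m - 1\<close> lines through \<open>p\<close> become \<open>x = a\<close> with \<open>a \<in> S\<close>, and the remaining
  \<open>n = d - m\<close> lines become \<open>y = l(x)\<close>; modularity of \<open>p\<close> says that any two of the latter are
  parallel or meet over a point of \<open>S\<close>. Hence, with \<open>P = \<Prod>(x - a)\<close>, there is a foliation
  \<open>dy/dx = g(x, y) / P(x)\<close> of degree \<open>m - 1\<close> leaving all lines of \<open>\<A>\<close> invariant: Newton
  interpolation yields \<open>g\<close> of total degree at most \<open>m - 1\<close> with \<open>g(x, l(x)) = l'(x) P(x)\<close>.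

  Straight leaves are inflectional, so \<open>G = P g\<^sub>x - P' g + g g\<^sub>y\<close>, the numerator of \<open>y''\<close>, vanishes
  on every line \<open>y = l(x)\<close>. If \<open>g\<close> has degree \<open>D \<ge> 2\<close> in \<open>y\<close>, then in characteristic zero \<open>G\<close>
  has degree exactly \<open>2D - 1 \<le> 2m - 3\<close> in \<open>y\<close>, so \<open>n \<le> 2m - 3\<close>. If \<open>D \<le> 1\<close>, all the lines
  \<open>y = l(x)\<close> pass through one point, which is then modular of multiplicity \<open>n + 1 \<le> m\<close>.
\<close>

subsection \<open>Total degree of bivariate polynomials\<close>

text \<open>Bivariate polynomials are elements of \<open>K[x][y]\<close>. The bounds are integers so that a negative bound
  expresses vanishing.\<close>

definition degree_bounded :: "int \<Rightarrow> 'a::zero poly \<Rightarrow> bool" where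
  "degree_bounded N p \<longleftrightarrow> p = 0 \<or> int (degree p) \<le> N"

definition total_degree_bounded :: "int \<Rightarrow> 'a::zero poly poly \<Rightarrow> bool" where
  "total_degree_bounded N g \<longleftrightarrow> (\<forall>i. degree_bounded (N - int i) (coeff g i))"

lemma degree_bounded_0 [simp]: "degree_bounded N 0"
  by (simp add: degree_bounded_def)

lemma degree_bounded_add:
  "degree_bounded N p \<Longrightarrow> degree_bounded N q \<Longrightarrow> degree_bounded N (p + q)"
  for p q :: "'a::comm_monoid_add poly"
  using degree_add_le_max[of p q] by (auto simp: degree_bounded_def)

lemma degree_bounded_diff:
  "degree_bounded N p \<Longrightarrow> degree_bounded N q \<Longrightarrow> degree_bounded N (p - q)"
  for p q :: "'a::ab_group_add poly"
  using degree_diff_le_max[of p q] by (auto simp: degree_bounded_def)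

lemma degree_bounded_mult:
  "degree_bounded M p \<Longrightarrow> degree_bounded N q \<Longrightarrow> degree_bounded (M + N) (p * q)"
  for p q :: "'a::comm_semiring_0 poly"
  using degree_mult_le[of p q] by (auto simp: degree_bounded_def)

lemma degree_bounded_sum:
  "(\<And>i. i \<in> I \<Longrightarrow> degree_bounded N (f i)) \<Longrightarrow> degree_bounded N (\<Sum>i\<in>I. f i)"
  for f :: "_ \<Rightarrow> 'a::comm_monoid_add poly"
  by (induction I rule: infinite_finite_induct) (auto intro: degree_bounded_add)

lemma total_degree_bounded_add:
  "total_degree_bounded N p \<Longrightarrow> total_degree_bounded N q \<Longrightarrow> total_degree_bounded N (p + q)"
  for p q :: "'a::comm_monoid_add poly poly"
  by (simp add: total_degree_bounded_def degree_bounded_add)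

lemma total_degree_bounded_diff:
  "total_degree_bounded N p \<Longrightarrow> total_degree_bounded N q \<Longrightarrow> total_degree_bounded N (p - q)"
  for p q :: "'a::ab_group_add poly poly"
  by (simp add: total_degree_bounded_def degree_bounded_diff)

lemma total_degree_bounded_mult:
  fixes p q :: "'a::comm_semiring_0 poly poly"
  assumes "total_degree_bounded M p" "total_degree_bounded N q"
  shows "total_degree_bounded (M + N) (p * q)"
  unfolding total_degree_bounded_def
proof
  fix i
  have "degree_bounded (M + N - int i) (coeff p j * coeff q (i - j))" if "j \<le> i" for j
  proof -
    have "degree_bounded (M - int j + (N - int (i - j))) (coeff p j * coeff q (i - j))"
      using assms by (intro degree_bounded_mult) (simp_all add: total_degree_bounded_def)
    then show ?thesis using that by (simp add: of_nat_diff algebra_simps)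
  qed
  then show "degree_bounded (M + N - int i) (coeff (p * q) i)"
    by (auto simp: coeff_mult intro!: degree_bounded_sum)
qed

lemma total_degree_bounded_const:
  "degree_bounded N c \<Longrightarrow> total_degree_bounded N [:c:]"
  by (auto simp: total_degree_bounded_def coeff_pCons split: nat.split)

lemma total_degree_bounded_linear:
  fixes k :: "'a::comm_ring_1 poly"
  assumes "degree k \<le> 1"
  shows "total_degree_bounded 1 [:- k, 1:]"
  using assms by (auto simp: total_degree_bounded_def coeff_pCons degree_bounded_def split: nat.split)

lemma total_degree_bounded_prod_linear:
  fixes X :: "'a::comm_ring_1 poly set"
  assumes "\<And>k. k \<in> X \<Longrightarrow> degree k \<le> 1"
  shows "total_degree_bounded (int (card X)) (\<Prod>k\<in>X. [:- k, 1:])"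
  using assms
proof (induction X rule: infinite_finite_induct)
  case (insert k X)
  then show ?case
    using total_degree_bounded_mult[OF total_degree_bounded_linear, of k "int (card X)"] by simp
qed (auto simp: total_degree_bounded_def coeff_pCons degree_bounded_def split: nat.split)

text \<open>Horner's scheme: peeling off the constant coefficient in \<open>y\<close> lowers the
  bound by one, and multiplying by \<open>l\<close> raises it by at most one.\<close>

lemma degree_bounded_poly:
  fixes l :: "'a::comm_ring_1 poly"
  assumes "total_degree_bounded N g" "degree l \<le> 1"
  shows "degree_bounded N (poly g l)"
  using assms(1)
proof (induction g arbitrary: N)
  case (pCons c g)
  have c: "degree_bounded N c"
    using pCons.prems unfolding total_degree_bounded_def by (metis coeff_pCons_0 of_nat_0 diff_zero)
  have "degree_bounded (N - 1 - int i) (coeff g i)" for i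
    using pCons.prems[unfolded total_degree_bounded_def, rule_format, of "Suc i"] by (simp add: algebra_simps)
  then have "degree_bounded (N - 1) (poly g l)"
    by (intro pCons.IH) (simp add: total_degree_bounded_def)
  moreover have "degree_bounded 1 l"
    using assms(2) by (simp add: degree_bounded_def)
  ultimately have "degree_bounded N (l * poly g l)"
    using degree_bounded_mult[of 1 l "N - 1"] by simp
  with c show ?case
    by (simp add: degree_bounded_add)
qed simp

text \<open>Synthetic division by \<open>y - l\<close>, read from the top coefficient down: each
  coefficient of \<open>g\<close> is the next higher coefficient of the product plus
  \<open>l\<close> times the next higher coefficient of \<open>g\<close>.\<close>

lemma total_degree_bounded_linear_factor:
  fixes l :: "'a::comm_ring_1 poly"
  assumes "total_degree_bounded N ([:- l, 1:] * g)" "degree l \<le> 1"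
  shows "total_degree_bounded (N - 1) g"
  unfolding total_degree_bounded_def
proof
  fix i
  show "degree_bounded (N - 1 - int i) (coeff g i)"
  proof (cases "i \<le> degree g")
    case True
    then show ?thesis
    proof (induction rule: inc_induct)
      case base
      have "coeff ([:- l, 1:] * g) (Suc (degree g)) = coeff g (degree g)"
        by (simp add: coeff_eq_0)
      then show ?case
        using assms(1)[unfolded total_degree_bounded_def, rule_format, of "Suc (degree g)"]
        by (simp add: algebra_simps)
    next
      case (step i)
      have "coeff g i = coeff ([:- l, 1:] * g) (Suc i) + l * coeff g (Suc i)"
        by simp
      moreover have "degree_bounded (N - 1 - int i) (coeff ([:- l, 1:] * g) (Suc i))"
        using assms(1)[unfolded total_degree_bounded_def, rule_format, of "Suc i"]
        by (simp add: algebra_simps)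
      moreover have "degree_bounded (N - 1 - int i) (l * coeff g (Suc i))"
        using degree_bounded_mult[of 1 l "N - 1 - int (Suc i)" "coeff g (Suc i)"] step.IH assms(2)
        by (auto simp: degree_bounded_def)
      ultimately show ?case
        by (metis degree_bounded_add)
    qed
  qed (simp add: coeff_eq_0)
qed

text \<open>The factors are split off one at a time. A new root \<open>k\<close> stays a root of the
  cofactor because the product already removed is nonzero at \<open>k\<close>.\<close>

lemma prod_linear_factors:
  fixes \<phi> :: "'a::idom poly poly"
  assumes "finite Y" "\<And>k. k \<in> Y \<Longrightarrow> poly \<phi> k = 0" "\<And>k. k \<in> Y \<Longrightarrow> degree k \<le> 1"
    and "total_degree_bounded N \<phi>"
  shows "\<exists>\<psi>. \<phi> = (\<Prod>k\<in>Y. [:- k, 1:]) * \<psi> \<and> total_degree_bounded (N - int (card Y)) \<psi>"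
  using assms(1-3)
proof (induction Y rule: finite_induct)
  case empty
  then show ?case using assms(4) by auto
next
  case (insert k Y)
  then obtain \<psi> where \<psi>: "\<phi> = (\<Prod>k\<in>Y. [:- k, 1:]) * \<psi>" "total_degree_bounded (N - int (card Y)) \<psi>"
    by auto
  have "poly (\<Prod>k\<in>Y. [:- k, 1:]) k \<noteq> 0"
    using insert.hyps by (auto simp: poly_prod)
  then have "poly \<psi> k = 0"
    using insert.prems(1)[of k] \<psi>(1) by simp
  then obtain \<eta> where \<eta>: "\<psi> = [:- k, 1:] * \<eta>"
    by (auto simp: poly_eq_0_iff_dvd dvd_def)
  have "total_degree_bounded (N - int (card Y) - 1) \<eta>"
    using total_degree_bounded_linear_factor \<psi>(2) \<eta> insert.prems(2) by blast
  then show ?case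
    using insert.hyps \<psi>(1) \<eta> by (intro exI[of _ \<eta>]) (auto simp: algebra_simps)
qed

text \<open>The chain rule along the curve \<open>y = l(x)\<close>: \<open>map_poly pderiv\<close>
  differentiates in \<open>x\<close>, the outer \<open>pderiv\<close> in \<open>y\<close>.\<close>

lemma pderiv_poly_poly:
  fixes g :: "'a::idom poly poly"
  shows "pderiv (poly g l) = poly (map_poly pderiv g) l + poly (pderiv g) l * pderiv l"
proof (induction g)
  case (pCons c g)
  have "map_poly pderiv (pCons c g) = pCons (pderiv c) (map_poly pderiv g)"
    by (rule poly_eqI) (simp add: coeff_map_poly coeff_pCons split: nat.split)
  then show ?case
    using pCons by (simp add: pderiv_add pderiv_mult pderiv_pCons algebra_simps)
qed simp

lemma degree_le_1_eq:
  assumes "degree l \<le> 1"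
  shows "l = [:coeff l 0, coeff l 1:]"
  using assms by (intro poly_eqI) (auto simp: coeff_pCons coeff_eq_0 split: nat.split)

lemma linear_poly_eq:
  fixes l :: "'a::idom poly"
  assumes "degree l \<le> 1" "poly l a = y"
  shows "l = [:y:] + smult (coeff l 1) [:- a, 1:]"
proof -
  obtain b c where "l = [:b, c:]"
    using degree_le_1_eq[OF assms(1)] by blast
  then show ?thesis using assms(2) by (auto simp: algebra_simps)
qed

subsection \<open>The foliation tangent to the arrangement\<close>

text \<open>The part \<open>Q\<close> already split off does not vanish at the new point
  \<open>b\<close>, so the cofactor carries the full order of \<open>e\<close> there.\<close>

lemma prod_linear_powers_dvd:
  fixes e :: "'a::idom poly"
  assumes "finite S" "\<And>a. a \<in> S \<Longrightarrow> [:- a, 1:] ^ n a dvd e"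
  shows "(\<Prod>a\<in>S. [:- a, 1:] ^ n a) dvd e"
  using assms
proof (induction S rule: finite_induct)
  case (insert b S)
  define Q where "Q = (\<Prod>a\<in>S. [:- a, 1:] ^ n a)"
  have Qb: "poly Q b \<noteq> 0"
    using insert.hyps by (auto simp: Q_def poly_prod)
  obtain r where r: "e = Q * r"
    using insert by (auto simp: Q_def dvd_def)
  have "[:- b, 1:] ^ n b dvd r"
  proof (cases "e = 0")
    case False
    then have "n b \<le> order b e"
      using insert.prems[of b] order_divides by blast
    also have "\<dots> = order b r"
      using r False Qb order_mult[of Q r b] by (simp add: order_0I)
    finally show ?thesis
      by (simp add: order_divides)
  qed (use r Qb in auto)
  then show ?case
    using insert.hyps r by (auto simp: Q_def mult.commute mult_dvd_mono)
qed simp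

lemma degree_prod_linear:
  "degree (\<Prod>i\<in>I. [:- f i, 1:]) = card I" for f :: "_ \<Rightarrow> 'a::idom"
  by (subst degree_prod_sum_eq) auto

text \<open>Adding \<open>h\<close> times the product of all \<open>y - k\<close> keeps the values
  on the earlier lines \<open>k\<close>, and the new line \<open>l\<close> forces \<open>h\<close>
  to be the error \<open>e\<close> divided by the product of all \<open>l - k\<close>. Crossings
  over \<open>S\<close> make this quotient a polynomial; parallel lines account for the rest of its
  degree bound.\<close>

lemma foliation_interpolation:
  fixes X :: "'a::field poly set" and S :: "'a set"
  defines "P \<equiv> \<Prod>a\<in>S. [:- a, 1:]"
  assumes "finite X" "finite S" "\<And>l. l \<in> X \<Longrightarrow> degree l \<le> 1"
    and "\<And>k l. k \<in> X \<Longrightarrow> l \<in> X \<Longrightarrow> coeff k 1 = coeff l 1 \<or> (\<exists>a\<in>S. poly k a = poly l a)"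
  shows "\<exists>g. total_degree_bounded (int (card S)) g \<and> (\<forall>l\<in>X. poly g l = smult (coeff l 1) P)"
  using assms(2,4,5)
proof (induction X rule: finite_induct)
  case empty
  show ?case by (intro exI[of _ 0]) (simp add: total_degree_bounded_def)
next
  case (insert l X)
  then obtain g where g: "total_degree_bounded (int (card S)) g"
    and gX: "\<And>k. k \<in> X \<Longrightarrow> poly g k = smult (coeff k 1) P"
    by auto
  have degl: "degree l \<le> 1" and degX: "\<And>k. k \<in> X \<Longrightarrow> degree k \<le> 1"
    using insert.prems(1) by auto
  define e where "e = smult (coeff l 1) P - poly g l"
  define Xp where "Xp = {k \<in> X. coeff k 1 = coeff l 1}"
  define Xn where "Xn = X - Xp"
  have fin: "finite Xp" "finite Xn"
    using insert.hyps by (auto simp: Xp_def Xn_def)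
  have split: "X = Xp \<union> Xn" "Xp \<inter> Xn = {}"
    by (auto simp: Xp_def Xn_def)
  have degP: "degree P = card S"
    unfolding P_def by (rule degree_prod_linear)

  have "degree (l - k) = 0" if "k \<in> Xp" for k
  proof -
    have "degree (l - k) \<le> 1"
      using that degl degX[of k] degree_diff_le by (auto simp: Xp_def)
    moreover have "coeff (l - k) 1 = 0"
      using that by (simp add: Xp_def)
    ultimately show ?thesis
      by (metis One_nat_def le_SucE le_zero_eq leading_coeff_0_iff degree_0)
  qed
  then have Xp_degree: "degree (\<Prod>k\<in>Xp. l - k) = 0"
    using degree_prod_sum_le[OF fin(1), of "\<lambda>k. l - k"] by simp
  \<comment> \<open>Parallel lines meet on the line at infinity, so each of them lowers the degree of the error.\<close>
  have e_bound: "degree_bounded (int (card S) - int (card Xp)) e"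
  proof -
    \<comment> \<open>Lines of equal slope prescribe the same value, so a term constant in
      \<open>y\<close> serves all of \<open>Xp\<close> and \<open>l\<close> at once.\<close>
    define \<phi> where "\<phi> = [:smult (coeff l 1) P:] - g"
    have "total_degree_bounded (int (card S)) \<phi>"
      unfolding \<phi>_def
      by (intro total_degree_bounded_diff total_degree_bounded_const g)
        (simp add: degree_bounded_def degP)
    moreover have "poly \<phi> k = 0" if "k \<in> Xp" for k
      using that gX[of k] by (simp add: Xp_def \<phi>_def)
    ultimately obtain \<psi> where \<psi>: "\<phi> = (\<Prod>k\<in>Xp. [:- k, 1:]) * \<psi>"
      "total_degree_bounded (int (card S) - int (card Xp)) \<psi>"
      using prod_linear_factors[OF fin(1), of \<phi>] degX Xp_def by blast
    have "degree_bounded 0 (\<Prod>k\<in>Xp. l - k)"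
      using Xp_degree by (simp add: degree_bounded_def)
    then have "degree_bounded (0 + (int (card S) - int (card Xp))) ((\<Prod>k\<in>Xp. l - k) * poly \<psi> l)"
      by (rule degree_bounded_mult) (rule degree_bounded_poly[OF \<psi>(2) degl])
    moreover have "e = (\<Prod>k\<in>Xp. l - k) * poly \<psi> l"
      using arg_cong[OF \<psi>(1), of "\<lambda>q. poly q l"] by (simp add: e_def \<phi>_def poly_prod)
    ultimately show ?thesis by simp
  qed

  have "\<exists>a\<in>S. poly k a = poly l a" if "k \<in> Xn" for k
    using insert.prems(2)[of k l] that by (auto simp: Xn_def Xp_def)
  then obtain r where r: "\<And>k. k \<in> Xn \<Longrightarrow> r k \<in> S" "\<And>k. k \<in> Xn \<Longrightarrow> poly k (r k) = poly l (r k)"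
    by metis
  define c where "c k = coeff l 1 - coeff k 1" for k
  have c0: "c k \<noteq> 0" if "k \<in> Xn" for k
    using that by (auto simp: c_def Xn_def Xp_def)
  have diff: "l - k = smult (c k) [:- r k, 1:]" if "k \<in> Xn" for k
  proof -
    have "degree k \<le> 1" using that degX by (auto simp: Xn_def)
    then show ?thesis
      using linear_poly_eq[OF degl refl, of "r k"] linear_poly_eq[of k "r k", OF _ r(2)[OF that]]
      by (metis add_diff_cancel_left c_def smult_diff_left)
  qed
  \<comment> \<open>\<open>n a\<close> counts the lines of \<open>X\<close> that cross
    \<open>l\<close> over \<open>a\<close> with a different slope; it is the order to which
    \<open>e\<close> must vanish at \<open>a\<close>.\<close>
  define n where "n a = card {k \<in> Xn. r k = a}" for a
  define Q where "Q = (\<Prod>k\<in>Xn. [:- r k, 1:])"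
  have Q_eq: "Q = (\<Prod>a\<in>S. [:- a, 1:] ^ n a)"
  proof -
    have "Q = (\<Prod>a\<in>S. \<Prod>k\<in>{k \<in> Xn. r k = a}. [:- r k, 1:])"
      unfolding Q_def using fin assms(3) r(1) by (intro prod.group[symmetric]) auto
    also have "\<dots> = (\<Prod>a\<in>S. [:- a, 1:] ^ n a)"
      by (intro prod.cong refl) (simp add: n_def)
    finally show ?thesis .
  qed

  \<comment> \<open>The pencil of lines through \<open>(a, y\<^sub>0)\<close> is interpolated by \<open>(y - y\<^sub>0) P / (x - a)\<close>, so the
    difference of this polynomial and \<open>g\<close> is divisible by the equations of all lines of \<open>X\<close> through this point.\<close>
  have "[:- a, 1:] ^ n a dvd e" if a: "a \<in> S" for a
  proof -
    define Xa where "Xa = {k \<in> Xn. r k = a}"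
    define Pa where "Pa = (\<Prod>b\<in>S - {a}. [:- b, 1:])"
    define y where "y = poly l a"
    define \<phi> where "\<phi> = [:Pa:] * [:- [:y:], 1:] - g"
    have Xa: "finite Xa" "Xa \<subseteq> X" "Xa \<subseteq> Xn"
      using fin by (auto simp: Xa_def Xn_def)
    have P: "P = [:- a, 1:] * Pa"
      unfolding P_def Pa_def using assms(3) a by (rule prod.remove)
    have "degree Pa = card S - 1"
      unfolding Pa_def degree_prod_linear using assms(3) a by simp
    moreover have "card S > 0" using a assms(3) by (auto simp: card_gt_0_iff)
    ultimately have "total_degree_bounded (int (card S) - 1) [:Pa:]"
      by (intro total_degree_bounded_const) (simp add: degree_bounded_def of_nat_diff)
    from total_degree_bounded_mult[OF this total_degree_bounded_linear, of "[:y:]"]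
    have "total_degree_bounded (int (card S)) \<phi>"
      unfolding \<phi>_def by (intro total_degree_bounded_diff g) simp
    have \<phi>_poly: "poly \<phi> k = smult (coeff k 1) P - poly g k"
      if "degree k \<le> 1" "poly k a = y" for k
    proof -
      have "k - [:y:] = smult (coeff k 1) [:- a, 1:]"
        using linear_poly_eq[OF that] by (metis add_diff_cancel_left')
      then have "(k - [:y:]) * Pa = smult (coeff k 1) P"
        unfolding P by (metis mult_smult_left)
      then show ?thesis by (simp add: \<phi>_def algebra_simps)
    qed
    have "poly \<phi> k = 0" if "k \<in> Xa" for k
    proof -
      have "poly k a = y"
        using that r(2) by (auto simp: Xa_def y_def)
      then show ?thesis
        using that Xa degX \<phi>_poly gX by (simp add: subset_iff)
    qed
    then obtain \<psi> where \<psi>: "\<phi> = (\<Prod>k\<in>Xa. [:- k, 1:]) * \<psi>"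
      using prod_linear_factors[OF Xa(1), of \<phi>] degX Xa(2) \<open>total_degree_bounded _ \<phi>\<close> by blast
    have "e = poly \<phi> l"
      using \<phi>_poly[OF degl] by (simp add: e_def y_def)
    also have "\<dots> = (\<Prod>k\<in>Xa. l - k) * poly \<psi> l"
      by (simp add: \<psi> poly_prod)
    finally have "(\<Prod>k\<in>Xa. l - k) dvd e" by simp
    moreover have "(\<Prod>k\<in>Xa. [:- a, 1:]) dvd (\<Prod>k\<in>Xa. l - k)"
    proof (rule prod_dvd_prod)
      fix k assume "k \<in> Xa"
      then have "l - k = smult (c k) [:- a, 1:]"
        using diff[of k] by (auto simp: Xa_def)
      then show "[:- a, 1:] dvd l - k" by (metis dvd_refl dvd_smult)
    qed
    ultimately show ?thesis
      by (auto simp: n_def Xa_def[symmetric] intro: dvd_trans)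
  qed
  then have "Q dvd e"
    unfolding Q_eq by (intro prod_linear_powers_dvd assms(3))

  \<comment> \<open>\<open>W\<close> is the Newton denominator. It equals \<open>Q\<close> up to a
    nonzero constant, since the parallel lines contribute only constants.\<close>
  define W where "W = (\<Prod>k\<in>X. l - k)"
  have W0: "W \<noteq> 0"
    using insert.hyps by (auto simp: W_def)
  have Wn: "(\<Prod>k\<in>Xn. l - k) = smult (\<Prod>k\<in>Xn. c k) Q"
    unfolding Q_def by (subst prod_smult[symmetric]) (rule prod.cong[OF refl diff])
  have "W = (\<Prod>k\<in>Xp. l - k) * (\<Prod>k\<in>Xn. l - k)"
    unfolding W_def split(1) by (rule prod.union_disjoint[OF fin split(2)])
  moreover obtain u where "(\<Prod>k\<in>Xp. l - k) = [:u:]"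
    using Xp_degree by (rule degree_eq_zeroE)
  ultimately have "W = smult (u * (\<Prod>k\<in>Xn. c k)) Q"
    using Wn by (simp add: mult.commute)
  then obtain w where w: "w \<noteq> 0" "W = smult w Q"
    using W0 by (metis smult_0_left)
  have "W dvd e"
    using w \<open>Q dvd e\<close> by (simp add: smult_dvd_iff)
  then obtain h where h: "e = W * h" ..
  \<comment> \<open>\<open>W\<close> has degree \<open>card Xn\<close> and \<open>e\<close> has
    degree at most \<open>card S - card Xp\<close>; subtracting leaves
    \<open>card S - card X\<close>.\<close>
  have h_bound: "degree_bounded (int (card S) - int (card X)) h"
  proof (cases "h = 0")
    case False
    then have "degree e = card Xn + degree h"
      using h W0 w degree_prod_linear[of r Xn] by (simp add: degree_mult_eq Q_def)
    moreover have "card X = card Xp + card Xn"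
      using split fin card_Un_disjoint by metis
    ultimately show ?thesis
      using e_bound h W0 False by (auto simp: degree_bounded_def)
  qed simp
  define g' where "g' = g + [:h:] * (\<Prod>k\<in>X. [:- k, 1:])"
  have "total_degree_bounded (int (card S)) g'"
    unfolding g'_def
    using total_degree_bounded_mult[OF total_degree_bounded_const[OF h_bound]
        total_degree_bounded_prod_linear, of X] degX g
    by (auto intro: total_degree_bounded_add)
  moreover have "poly g' l = smult (coeff l 1) P"
  proof -
    have "poly g' l = poly g l + h * W"
      by (simp add: g'_def poly_prod W_def)
    then show ?thesis using h by (simp add: e_def algebra_simps)
  qed
  moreover have "poly g' k = smult (coeff k 1) P" if "k \<in> X" for k
    using that gX insert.hyps(1) by (auto simp: g'_def poly_prod)
  ultimately show ?case by auto
qed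

section \<open>Counting the invariant lines of the foliation\<close>

text \<open>The lines are roots in \<open>K[x]\<close> of the polynomial \<open>G\<close> in
  \<open>y\<close>, so its degree bounds their number when \<open>G\<close> is nonzero. The last two
  alternatives are pencils centred at infinity or at an affine point, where \<open>G\<close> can
  vanish identically.\<close>

lemma card_lines_le:
  fixes X :: "'a::field_char_0 poly set" and S :: "'a set"
  assumes "finite X" "finite S" "\<And>l. l \<in> X \<Longrightarrow> degree l \<le> 1"
    and "\<And>k l. k \<in> X \<Longrightarrow> l \<in> X \<Longrightarrow> coeff k 1 = coeff l 1 \<or> (\<exists>a\<in>S. poly k a = poly l a)"
  shows "card X \<le> 2 * card S - 1 \<or> (\<exists>c. \<forall>l\<in>X. coeff l 1 = c) \<or> (\<exists>a y. \<forall>l\<in>X. poly l a = y)"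
proof -
  define P where "P = (\<Prod>a\<in>S. [:- a, 1:])"
  have P0: "P \<noteq> 0" using assms(2) by (auto simp: P_def)
  obtain g where g: "total_degree_bounded (int (card S)) g"
    and gX: "\<And>l. l \<in> X \<Longrightarrow> poly g l = smult (coeff l 1) P"
    using foliation_interpolation[OF assms] unfolding P_def by blast
  have pderivX: "pderiv l = [:coeff l 1:]" if "l \<in> X" for l
  proof -
    obtain b c where "l = [:b, c:]"
      using degree_le_1_eq[OF assms(3)] \<open>l \<in> X\<close> by metis
    then show ?thesis by (simp add: pderiv_pCons)
  qed
  show ?thesis
  proof (cases "degree g \<ge> 2")
    case True
    define D where "D = degree g"
    define G where "G = smult P (map_poly pderiv g) - smult (pderiv P) g + g * pderiv g"
    have "g \<noteq> 0" using True by auto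
    have "D \<le> card S"
      using g[unfolded total_degree_bounded_def, rule_format, of D] \<open>g \<noteq> 0\<close>
      by (auto simp: degree_bounded_def D_def)
    \<comment> \<open>\<open>D < 2 * D - 1\<close> because \<open>D \<ge> 2\<close>, so these terms
      cannot cancel the leading term of \<open>g * pderiv g\<close>.\<close>
    have low: "degree (smult P (map_poly pderiv g) - smult (pderiv P) g) \<le> D"
      by (intro degree_diff_le order.trans[OF degree_smult_le] degree_le)
        (auto simp: D_def coeff_map_poly coeff_eq_0)
    \<comment> \<open>Characteristic zero enters here: differentiation in \<open>y\<close> lowers
      the degree by exactly one.\<close>
    have "pderiv g \<noteq> 0" using True by (simp add: pderiv_eq_0_iff)
    then have high: "degree (g * pderiv g) = 2 * D - 1"
      using \<open>g \<noteq> 0\<close> True by (simp add: degree_mult_eq degree_pderiv D_def)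
    have "degree G = 2 * D - 1"
      unfolding G_def high[symmetric] using low high True
      by (intro degree_add_eq_right) (simp add: D_def)
    moreover from this have "G \<noteq> 0" using True by (auto simp: D_def)
    \<comment> \<open>Differentiating \<open>g(x, l(x)) = l' P\<close> with constant
      \<open>l'\<close> expresses the value of the \<open>x\<close>-derivative of \<open>g\<close>
      on the line; substituting it cancels all terms of \<open>G\<close>.\<close>
    moreover have "poly G l = 0" if "l \<in> X" for l
    proof -
      have "poly (map_poly pderiv g) l + poly (pderiv g) l * [:coeff l 1:] = smult (coeff l 1) (pderiv P)"
        using pderiv_poly_poly[of g l] gX[OF that] pderivX[OF that] by (simp add: pderiv_smult)
      then have 1: "poly (map_poly pderiv g) l = smult (coeff l 1) (pderiv P) - smult (coeff l 1) (poly (pderiv g) l)"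
        by (simp add: algebra_simps)
      show ?thesis
        unfolding G_def by (simp add: 1 gX[OF that] algebra_simps smult_diff_right)
    qed
    then have "X \<subseteq> {l. poly G l = 0}" by blast
    ultimately have "card X \<le> 2 * D - 1"
      using card_poly_roots_bound[of G] poly_roots_finite[of G]
        card_mono[of "{l. poly G l = 0}" X] by simp
    then have "card X \<le> 2 * card S - 1" using \<open>D \<le> card S\<close> by linarith
    then show ?thesis ..
  next
    case False
    obtain g0 g1 where g01: "g = [:g0, g1:]"
      using False degree_le_1_eq[of g] by force
    have eq: "smult (coeff l 1) P = g0 + l * g1" if "l \<in> X" for l
      using gX[OF that] by (simp add: g01)
    show ?thesis
    proof (cases "\<exists>c. \<forall>l\<in>X. coeff l 1 = c")
      case False
      then obtain k k' where k: "k \<in> X" "k' \<in> X" "coeff k 1 \<noteq> coeff k' 1" by metis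
      then obtain a where a: "poly k a = poly k' a" using assms(4) by blast
      \<comment> \<open>Subtracting two invariance equations eliminates \<open>g0\<close>. Applied
        to the two crossing lines this gives \<open>P = (x - a) g1\<close>; cancelling
        \<open>g1\<close> then sends every line through their crossing point.\<close>
      have diff: "smult (coeff l 1 - coeff k 1) P = (l - k) * g1" if "l \<in> X" for l
        using eq[OF that] eq[OF k(1)] by (simp add: smult_diff_left algebra_simps)
      define c where "c = coeff k' 1 - coeff k 1"
      have "k' - k = smult c [:- a, 1:]"
        using linear_poly_eq[OF assms(3)[OF k(1)] a] linear_poly_eq[OF assms(3)[OF k(2)] refl, of a]
        by (metis add_diff_cancel_left c_def smult_diff_left)
      then have "smult c P = smult c ([:- a, 1:] * g1)"
        using diff[OF k(2)] by (metis c_def mult_smult_left)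
      then have P: "P = [:- a, 1:] * g1"
        using k(3) by (metis c_def eq_iff_diff_eq_0 smult_cancel)
      have "poly l a = poly k a" if "l \<in> X" for l
      proof -
        have "smult (coeff l 1 - coeff k 1) [:- a, 1:] * g1 = (l - k) * g1"
          using diff[OF that] P by (metis mult_smult_left)
        then have "smult (coeff l 1 - coeff k 1) [:- a, 1:] = l - k"
          using P P0 by (metis mult_cancel_right mult_zero_right)
        from arg_cong[OF this, of "\<lambda>p. poly p a"] show ?thesis by simp
      qed
      then show ?thesis by blast
    qed blast
  qed
qed

subsection \<open>Projective geometry and affine coordinates\<close>

text \<open>Two planes in a space of dimension three intersect in dimension at least 2 + 2 - 3, and
  dimension two would make them equal.\<close>

lemma proj_lines_meet:
  assumes "L \<in> proj_lines" "L' \<in> proj_lines" "L \<noteq> L'"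
  shows "L \<inter> L' \<in> proj_points"
proof -
  have sub: "vec.subspace L" "vec.subspace L'" and dims: "vec.dim L = 2" "vec.dim L' = 2"
    using assms by (auto simp: proj_lines_def)
  have sum: "vec.dim {x + y |x y. x \<in> L \<and> y \<in> L'} + vec.dim (L \<inter> L') = 4"
    using vec.dim_sums_Int[OF sub] dims by simp
  have "vec.dim {x + y |x y. x \<in> L \<and> y \<in> L'} \<le> 3"
    using vec.dim_subset_UNIV[of "{x + y |x y. x \<in> L \<and> y \<in> L'}"]
    by (simp add: vec.dimension_def card_cart_basis)
  moreover have "vec.dim (L \<inter> L') \<noteq> 2"
  proof
    assume "vec.dim (L \<inter> L') = 2"
    then have "L \<inter> L' = L" "L \<inter> L' = L'"
      using vec.subspace_dim_equal[of "L \<inter> L'" L] vec.subspace_dim_equal[of "L \<inter> L'" L'] sub dims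
      by (auto simp: vec.subspace_inter)
    then show False using assms(3) by simp
  qed
  moreover have "vec.dim (L \<inter> L') \<le> 2"
    using vec.dim_subset[of "L \<inter> L'" L] dims by simp
  ultimately show ?thesis
    using sum sub by (auto simp: proj_points_def vec.subspace_inter)
qed

lemma proj_point_subset_eq:
  assumes "p \<in> proj_points" "q \<in> proj_points" "p \<subseteq> q"
  shows "p = q"
  using assms vec.subspace_dim_equal[of p q] by (auto simp: proj_points_def)

lemma proj_point_subset_line_through:
  "p \<subseteq> line_through p q" "q \<subseteq> line_through p q"
  unfolding line_through_def by (meson Un_upper1 Un_upper2 order.trans vec.span_superset)+

lemma line_through_eq:
  assumes "p \<in> proj_points" "q \<in> proj_points" "p \<noteq> q" "L \<in> proj_lines" "p \<subseteq> L" "q \<subseteq> L"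
  shows "line_through p q = L"
proof -
  have sub: "line_through p q \<subseteq> L"
    unfolding line_through_def using assms
    by (intro vec.span_minimal) (auto simp: proj_lines_def)
  note pq = proj_point_subset_line_through
  have "vec.dim (line_through p q) \<noteq> 1"
  proof
    assume "vec.dim (line_through p q) = 1"
    then have "line_through p q \<in> proj_points"
      by (simp add: proj_points_def line_through_def vec.subspace_span del: vec.dim_span)
    then show False using pq assms(1-3) proj_point_subset_eq by metis
  qed
  moreover have "vec.dim (line_through p q) \<ge> 1"
    using vec.dim_subset[OF pq(1), of p q] assms(1) by (simp add: proj_points_def)
  ultimately show ?thesis
    using vec.subspace_dim_equal[of "line_through p q" L] sub assms(4)
    by (simp add: proj_lines_def line_through_def vec.subspace_span del: vec.dim_span)
qed

lemma line_through_commute: "line_through p q = line_through q p"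
  by (simp add: line_through_def Un_commute)

lemma proj_point_span:
  "v \<noteq> 0 \<Longrightarrow> vec.span {v} \<in> proj_points"
  by (simp add: proj_points_def vec.subspace_span vec.dim_singleton)

lemma proj_pointE:
  assumes "p \<in> proj_points"
  obtains v where "v \<noteq> 0" "v \<in> p" "p = vec.span {v}"
proof -
  have "p \<noteq> {0}" "0 \<in> p"
    using assms by (auto simp: proj_points_def vec.subspace_0)
  then obtain v where v: "v \<in> p" "v \<noteq> 0" by blast
  then have "vec.span {v} \<subseteq> p"
    using assms by (intro vec.span_minimal) (auto simp: proj_points_def)
  then have "vec.span {v} = p"
    using assms v proj_point_span proj_point_subset_eq by blast
  then show ?thesis using that v by blast
qed

lemma span_insert_proj_line:
  assumes "L \<in> proj_lines" "v \<notin> L"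
  obtains k where "x - k *s v \<in> L"
proof -
  have span: "vec.span L = L" using assms(1) by (simp add: proj_lines_def vec.span_eq_iff)
  have "vec.dim (insert v L) = 3"
    using assms vec.dim_insert[of v L] by (simp add: span proj_lines_def)
  then have "vec.span (insert v L) = UNIV"
    using vec.dim_eq_full[of "insert v L"] by (simp add: vec.dimension_def card_cart_basis)
  then show ?thesis using that vec.span_breakdown_eq[of x v L] span by blast
qed

text \<open>The centre \<open>q\<close> is itself modular: an intersection point \<open>r\<close>
  other than \<open>p\<close> lies on some line of \<open>N\<close>, as otherwise every line through
  \<open>r\<close> would be the line \<open>pr\<close>; for \<open>r\<close> different from
  \<open>q\<close>, that line of \<open>N\<close> is \<open>qr\<close>. Maximality of
  \<open>m\<close> then bounds the lines through \<open>q\<close>, which include \<open>N\<close>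
  and the line \<open>pq\<close>.\<close>

lemma card_pencil_bound:
  assumes arr: "line_arrangement \<A>" and p: "modular_point \<A> p"
    and max: "\<And>q. modular_point \<A> q \<Longrightarrow> multiplicity_at \<A> q \<le> m"
    and q: "q \<in> proj_points" "q \<noteq> p" and N: "N = {L \<in> \<A>. \<not> p \<subseteq> L}"
    and qN: "\<And>L. L \<in> N \<Longrightarrow> q \<subseteq> L" and card: "card N \<ge> 2"
  shows "card N + 1 \<le> m"
proof -
  have fin: "finite \<A>" and lines: "\<And>L. L \<in> \<A> \<Longrightarrow> L \<in> proj_lines"
    using arr by (auto simp: line_arrangement_def)
  have p_pt: "p \<in> proj_points"
    using p by (simp add: modular_point_def intersection_points_def)
  have "N \<subseteq> {L \<in> \<A>. q \<subseteq> L}" using qN N by auto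
  then have q_int: "q \<in> intersection_points \<A>"
    using q(1) card fin card_mono[of "{L \<in> \<A>. q \<subseteq> L}" N]
    by (simp add: intersection_points_def multiplicity_at_def)
  then have pq: "line_through p q \<in> \<A>"
    using p q(2) by (simp add: modular_point_def)
  have "modular_point \<A> q"
    unfolding modular_point_def
  proof (intro conjI ballI impI q_int)
    fix r assume r: "r \<in> intersection_points \<A>" "r \<noteq> q"
    then have r_pt: "r \<in> proj_points" by (simp add: intersection_points_def)
    show "line_through q r \<in> \<A>"
    proof (cases "r = p")
      case True
      then show ?thesis using pq by (simp add: line_through_commute)
    next
      case False
      have "\<exists>L\<in>N. r \<subseteq> L"
      proof (rule ccontr)
        assume "\<not> ?thesis"
        then have "{L \<in> \<A>. r \<subseteq> L} \<subseteq> {line_through p r}"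
          using N line_through_eq[OF p_pt r_pt] False lines by blast
        then have "card {L \<in> \<A>. r \<subseteq> L} \<le> 1"
          using card_mono[of "{line_through p r}"] by simp
        then show False using r(1) by (simp add: intersection_points_def multiplicity_at_def)
      qed
      then obtain L where "L \<in> N" "r \<subseteq> L" by blast
      moreover from this have "line_through q r = L"
        using line_through_eq[OF q(1) r_pt] r(2) qN N lines by blast
      ultimately show ?thesis using N by simp
    qed
  qed
  then have "card {L \<in> \<A>. q \<subseteq> L} \<le> m"
    using max by (simp add: multiplicity_at_def)
  moreover have "insert (line_through p q) N \<subseteq> {L \<in> \<A>. q \<subseteq> L}"
    using pq qN N proj_point_subset_line_through by auto
  then have "card (insert (line_through p q) N) \<le> card {L \<in> \<A>. q \<subseteq> L}"
    using fin by (intro card_mono) auto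
  moreover have "line_through p q \<notin> N"
    using N proj_point_subset_line_through by auto
  ultimately show ?thesis
    using fin N by simp
qed

section \<open>Affine coordinates with \<open>p\<close> at infinity\<close>

text \<open>The vectors \<open>u\<close>, \<open>v\<close>, \<open>w\<close> form a basis adapted to
  the flag \<open>p\<close>, \<open>L\<^sub>0\<close>. For coefficients \<open>s\<close>,
  \<open>t\<close>, \<open>r\<close>, the line at infinity \<open>L\<^sub>0\<close> is
  \<open>r = 0\<close>, the affine coordinates are \<open>x = t / r\<close> and
  \<open>y = s / r\<close>, and \<open>p\<close> is the vertical direction.\<close>

locale affine_frame =
  fixes p L\<^sub>0 :: "(complex ^ 3) set" and u v w :: "complex ^ 3"
  assumes p: "p \<in> proj_points" and L\<^sub>0: "L\<^sub>0 \<in> proj_lines" and pL\<^sub>0: "p \<subseteq> L\<^sub>0"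
    and u: "u \<in> p" "p = vec.span {u}" and v: "v \<in> L\<^sub>0" "v \<notin> p" and w: "w \<notin> L\<^sub>0"
begin

lemma u_notin: "L \<in> proj_lines \<Longrightarrow> \<not> p \<subseteq> L \<Longrightarrow> u \<notin> L"
  using u vec.span_minimal[of "{u}" L] by (auto simp: proj_lines_def)

lemma L\<^sub>0E:
  assumes "x \<in> L\<^sub>0"
  obtains s t where "x = s *s u + t *s v"
proof -
  have sub: "vec.subspace L\<^sub>0" "vec.dim L\<^sub>0 = 2" using L\<^sub>0 by (auto simp: proj_lines_def)
  have "vec.span {v, u} \<subseteq> L\<^sub>0"
    using u v pL\<^sub>0 sub by (intro vec.span_minimal) auto
  moreover have "vec.dim (vec.span {v, u}) = 2"
    using p v(2) u by (simp add: vec.dim_insert proj_points_def)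
  ultimately have "vec.span {v, u} = L\<^sub>0"
    using vec.subspace_dim_equal[of "vec.span {v, u}" L\<^sub>0] sub by (simp add: vec.subspace_span)
  then obtain t where "x - t *s v \<in> vec.span {u}"
    using assms vec.span_breakdown_eq by blast
  then obtain s where "x - t *s v = s *s u"
    by (auto simp: vec.span_singleton)
  then show ?thesis using that[of s t] by (simp add: algebra_simps)
qed

lemma coordinatesE:
  obtains s t r where "x = s *s u + t *s v + r *s w"
proof -
  obtain r where "x - r *s w \<in> L\<^sub>0" using span_insert_proj_line[OF L\<^sub>0 w] .
  then obtain s t where "x - r *s w = s *s u + t *s v" by (rule L\<^sub>0E)
  then show ?thesis using that[of s t r] by (simp add: algebra_simps)
qed

text \<open>As \<open>u\<close> lies off \<open>L\<close>, both \<open>v\<close> and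
  \<open>w\<close> can be shifted along \<open>u\<close> into \<open>L\<close>. The shifts are the
  slope \<alpha> and the intercept \<beta>, and the remaining multiple of \<open>u\<close> must
  vanish.\<close>

lemma line_equation:
  assumes "L \<in> proj_lines" "\<not> p \<subseteq> L"
  shows "\<exists>\<alpha> \<beta>. \<forall>s t r. s *s u + t *s v + r *s w \<in> L \<longleftrightarrow> s = t * \<alpha> + r * \<beta>"
proof -
  have uL: "u \<notin> L" using assms by (rule u_notin)
  have sub: "vec.subspace L" using assms by (simp add: proj_lines_def)
  obtain \<alpha> where "v - (- \<alpha>) *s u \<in> L"
    using span_insert_proj_line[OF assms(1) uL, of v] by (metis minus_minus)
  moreover obtain \<beta> where "w - (- \<beta>) *s u \<in> L"
    using span_insert_proj_line[OF assms(1) uL, of w] by (metis minus_minus)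
  ultimately have vw: "v + \<alpha> *s u \<in> L" "w + \<beta> *s u \<in> L" by simp_all
  have scale_u: "k *s u \<in> L \<longleftrightarrow> k = 0" for k
  proof
    assume "k *s u \<in> L"
    then have "inverse k *s (k *s u) \<in> L" by (rule vec.subspace_scale[OF sub])
    then show "k = 0" using uL by (cases "k = 0") (auto simp: vector_smult_assoc)
  qed (simp add: vec.subspace_0[OF sub])
  have "s *s u + t *s v + r *s w \<in> L \<longleftrightarrow> s = t * \<alpha> + r * \<beta>" for s t r
  proof -
    have eq: "s *s u + t *s v + r *s w =
        t *s (v + \<alpha> *s u) + r *s (w + \<beta> *s u) + (s - (t * \<alpha> + r * \<beta>)) *s u"
      by (simp add: vec_eq_iff algebra_simps)
    have in_L: "t *s (v + \<alpha> *s u) + r *s (w + \<beta> *s u) \<in> L"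
      by (rule vec.subspace_add[OF sub]) (rule vec.subspace_scale[OF sub vw(1)] vec.subspace_scale[OF sub vw(2)])+
    have "s *s u + t *s v + r *s w \<in> L \<longleftrightarrow> (s - (t * \<alpha> + r * \<beta>)) *s u \<in> L"
      unfolding eq using in_L sub
      by (metis add_diff_cancel_left' vec.subspace_add vec.subspace_diff)
    also have "\<dots> \<longleftrightarrow> s = t * \<alpha> + r * \<beta>"
      by (simp only: scale_u eq_iff_diff_eq_0[symmetric])
    finally show ?thesis .
  qed
  then show ?thesis by blast
qed

end

section \<open>Translation of the arrangement into polynomials\<close>

theorem theorem1p1:
  fixes \<A> :: "(complex ^ 3) set set" and p :: "(complex ^ 3) set" and m :: nat
  assumes "line_arrangement \<A>"
    and "supersolvable \<A>"
    and "modular_point \<A> p"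
    and "multiplicity_at \<A> p = m"
    and "\<And>q. modular_point \<A> q \<Longrightarrow> multiplicity_at \<A> q \<le> m"
    and "m \<ge> 2"
  shows "card \<A> \<le> 3 * m - 3"
proof -
  have fin: "finite \<A>" and lines: "\<And>L. L \<in> \<A> \<Longrightarrow> L \<in> proj_lines"
    using assms(1) by (auto simp: line_arrangement_def)
  have sub: "\<And>L. L \<in> \<A> \<Longrightarrow> vec.subspace L"
    using lines by (simp add: proj_lines_def)
  have p: "p \<in> proj_points"
    using assms(3) by (simp add: modular_point_def intersection_points_def)
  define M where "M = {L \<in> \<A>. p \<subseteq> L}"
  define N where "N = {L \<in> \<A>. \<not> p \<subseteq> L}"
  have card_M: "card M = m" and finM: "finite M" and finN: "finite N"
    using assms(4) fin by (auto simp: multiplicity_at_def M_def N_def)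
  have "card \<A> = card (M \<union> N)"
    by (rule arg_cong[of _ _ card]) (auto simp: M_def N_def)
  also have "\<dots> = m + card N"
    using finM finN card_M by (subst card_Un_disjoint) (auto simp: M_def N_def)
  finally have card_A: "card \<A> = m + card N" .
  have "M \<noteq> {}" using card_M assms(6) by auto
  then obtain L\<^sub>0 where L\<^sub>0_M: "L\<^sub>0 \<in> M" by blast
  obtain u where u: "u \<noteq> 0" "u \<in> p" "p = vec.span {u}"
    using p by (rule proj_pointE)
  have L\<^sub>0': "L\<^sub>0 \<in> proj_lines" "p \<subseteq> L\<^sub>0" using L\<^sub>0_M lines by (auto simp: M_def)
  have "L\<^sub>0 \<noteq> p" using L\<^sub>0' p by (auto simp: proj_lines_def proj_points_def)
  then obtain v where v: "v \<in> L\<^sub>0" "v \<notin> p" using L\<^sub>0' by blast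
  have "L\<^sub>0 \<noteq> UNIV"
    using L\<^sub>0'(1) by (auto simp: proj_lines_def vec.dim_UNIV card_cart_basis)
  then obtain w where w: "w \<notin> L\<^sub>0" by blast
  interpret affine_frame p L\<^sub>0 u v w
    using p L\<^sub>0' u v w by unfold_locales auto

  \<comment> \<open>\<open>w + a *s v\<close> represents the affine point \<open>(a, 0)\<close>, so
    \<open>S\<close> collects the abscissas of the vertical lines. Two such points on one line
    through \<open>p\<close> would put \<open>v\<close> on it and make it \<open>L\<^sub>0\<close>,
    whence at most \<open>m - 1\<close> abscissas.\<close>
  define S where "S = {a. \<exists>T\<in>M - {L\<^sub>0}. w + a *s v \<in> T}"
  then have "\<forall>a\<in>S. \<exists>T. T \<in> M - {L\<^sub>0} \<and> w + a *s v \<in> T" by blast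
  then obtain T where T: "\<And>a. a \<in> S \<Longrightarrow> T a \<in> M - {L\<^sub>0}" "\<And>a. a \<in> S \<Longrightarrow> w + a *s v \<in> T a"
    by metis
  have v_notin: "v \<notin> L" if "L \<in> M - {L\<^sub>0}" for L
  proof
    assume "v \<in> L"
    moreover have "u \<in> L" and subL: "vec.subspace L" and L: "L \<in> proj_lines"
      using that u sub lines by (auto simp: M_def)
    ultimately have "L\<^sub>0 \<subseteq> L"
      by (metis L\<^sub>0E subsetI vec.subspace_add vec.subspace_scale)
    then have "L\<^sub>0 = L"
      using L\<^sub>0' L vec.subspace_dim_equal[of L\<^sub>0 L] by (auto simp: proj_lines_def)
    then show False using that by simp
  qed
  have "inj_on T S"
  proof (rule inj_onI, rule ccontr)
    fix a b assume ab: "a \<in> S" "b \<in> S" "T a = T b" "a \<noteq> b"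
    have subT: "vec.subspace (T a)" using T(1)[OF ab(1)] sub by (simp add: M_def)
    have "(w + a *s v) - (w + b *s v) \<in> T a"
      using T(2)[OF ab(1)] T(2)[OF ab(2)] ab(3) by (intro vec.subspace_diff[OF subT]) simp_all
    then have "inverse (a - b) *s ((w + a *s v) - (w + b *s v)) \<in> T a"
      by (rule vec.subspace_scale[OF subT])
    also have "inverse (a - b) *s ((w + a *s v) - (w + b *s v)) = v"
    proof -
      have "(w + a *s v) - (w + b *s v) = (a - b) *s v"
        by (simp add: vec.scale_left_diff_distrib)
      then show ?thesis using ab(4) by (simp only: vector_smult_assoc) simp
    qed
    finally show False using v_notin T(1) ab(1) by blast
  qed
  moreover have "T ` S \<subseteq> M - {L\<^sub>0}" using T(1) by blast
  ultimately have finS: "finite S" and card_S: "card S \<le> m - 1"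
    using finM card_inj_on_le[of T S "M - {L\<^sub>0}"] card_M L\<^sub>0_M inj_on_finite[of T S "M - {L\<^sub>0}"]
    by auto

  have "\<forall>L\<in>N. \<exists>\<alpha> \<beta>. \<forall>s t r. s *s u + t *s v + r *s w \<in> L \<longleftrightarrow> s = t * \<alpha> + r * \<beta>"
    using line_equation lines by (simp add: N_def)
  then obtain \<alpha> \<beta> where mem_iff:
    "\<And>L s t r. L \<in> N \<Longrightarrow> s *s u + t *s v + r *s w \<in> L \<longleftrightarrow> s = t * \<alpha> L + r * \<beta> L"
    by metis
  define l where "l L = [:\<beta> L, \<alpha> L:]" for L
  have inj: "inj_on l N"
  proof (rule inj_onI)
    fix L L' assume LL': "L \<in> N" "L' \<in> N" "l L = l L'"
    then have "s *s u + t *s v + r *s w \<in> L \<longleftrightarrow> s *s u + t *s v + r *s w \<in> L'" for s t r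
      by (simp add: mem_iff l_def)
    then show "L = L'" by (metis coordinatesE subsetI subset_antisym)
  qed
  \<comment> \<open>Modularity puts the common point on a line \<open>K\<close> through
    \<open>p\<close>. At infinity (\<open>r = 0\<close>) the slopes agree; otherwise
    \<open>K\<close> is vertical and its abscissa \<open>t / r\<close> lies in
    \<open>S\<close>.\<close>
  have meet: "\<alpha> L = \<alpha> L' \<or> (\<exists>a\<in>S. poly (l L) a = poly (l L') a)" if L: "L \<in> N" "L' \<in> N" "L \<noteq> L'" for L L'
  proof -
    have "L \<inter> L' \<in> proj_points"
      using L lines by (intro proj_lines_meet) (auto simp: N_def)
    moreover have "L \<inter> L' \<noteq> p" using L by (auto simp: N_def)
    moreover have "card {L, L'} \<le> card {K \<in> \<A>. L \<inter> L' \<subseteq> K}"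
      using L fin by (intro card_mono) (auto simp: N_def)
    ultimately have "line_through p (L \<inter> L') \<in> \<A>"
      using assms(3) L(3)
      by (simp add: modular_point_def intersection_points_def multiplicity_at_def)
    then obtain K where K: "K \<in> M" "L \<inter> L' \<subseteq> K"
      using that[of "line_through p (L \<inter> L')"] proj_point_subset_line_through by (simp add: M_def)
    obtain x where x: "x \<noteq> 0" "x \<in> L \<inter> L'"
      using \<open>L \<inter> L' \<in> proj_points\<close> by (rule proj_pointE)
    obtain s t r where str: "x = s *s u + t *s v + r *s w" by (rule coordinatesE)
    have s: "s = t * \<alpha> L + r * \<beta> L" "s = t * \<alpha> L' + r * \<beta> L'"
      using x(2) L mem_iff str by auto
    show ?thesis
    proof (cases "r = 0")
      case True
      then have "t \<noteq> 0" using s x(1) str by auto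
      then show ?thesis using s True by simp
    next
      case False
      have subK: "vec.subspace K" and uK: "u \<in> K" using K sub u by (auto simp: M_def)
      \<comment> \<open>Moving along the direction \<open>u\<close> of \<open>p\<close> stays on
        \<open>K\<close> and reaches the point \<open>(t / r, 0)\<close>.\<close>
      have "inverse r *s (x - s *s u) \<in> K"
        using K x(2) uK by (intro vec.subspace_scale[OF subK] vec.subspace_diff[OF subK]) auto
      also have "inverse r *s (x - s *s u) = w + (t / r) *s v"
        using False by (simp add: str vec_eq_iff field_simps)
      finally have in_K: "w + (t / r) *s v \<in> K" .
      have "K \<noteq> L\<^sub>0"
      proof
        assume "K = L\<^sub>0"
        then have "w + (t / r) *s v - (t / r) *s v \<in> L\<^sub>0"
          using in_K v subK by (intro vec.subspace_diff vec.subspace_scale) auto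
        then show False using w by simp
      qed
      then have "t / r \<in> S" using K(1) in_K by (auto simp: S_def)
      moreover have "poly (l L) (t / r) = s / r" "poly (l L') (t / r) = s / r"
        using s False by (simp_all add: l_def field_simps)
      ultimately show ?thesis by metis
    qed
  qed

  have trichotomy: "card (l ` N) \<le> 2 * card S - 1 \<or> (\<exists>c. \<forall>k\<in>l ` N. coeff k 1 = c)
      \<or> (\<exists>a y. \<forall>k\<in>l ` N. poly k a = y)"
  proof (rule card_lines_le)
    fix k k' assume "k \<in> l ` N" "k' \<in> l ` N"
    then show "coeff k 1 = coeff k' 1 \<or> (\<exists>a\<in>S. poly k a = poly k' a)"
      using meet by (force simp: l_def)
  qed (use finN finS in \<open>auto simp: l_def\<close>)
  \<comment> \<open>For at least two lines, \<open>card N + 1 \<le> m\<close> forces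
    \<open>m \<ge> 3\<close>, hence \<open>m - 1 \<le> 2 * m - 3\<close>; for fewer lines
    \<open>m \<ge> 2\<close> suffices.\<close>
  have pencil: "card N \<le> 2 * m - 3"
    if x: "x \<notin> p" and xN: "\<And>L. L \<in> N \<Longrightarrow> x \<in> L" for x
  proof (cases "card N \<ge> 2")
    case True
    have "x \<noteq> 0" using x p by (auto simp: proj_points_def vec.subspace_0)
    have "vec.span {x} \<subseteq> L" if "L \<in> N" for L
      using xN[OF that] that sub by (intro vec.span_minimal) (auto simp: N_def)
    moreover have "vec.span {x} \<noteq> p" using x vec.span_base[of x "{x}"] by auto
    ultimately have "card N + 1 \<le> m"
      using card_pencil_bound[OF assms(1,3,5) proj_point_span[OF \<open>x \<noteq> 0\<close>] _ N_def] True by blast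
    then show ?thesis using True by simp
  qed (use assms(6) in simp)
  consider "card (l ` N) \<le> 2 * card S - 1" | c where "\<forall>L\<in>N. coeff (l L) 1 = c"
    | a y where "\<forall>L\<in>N. poly (l L) a = y"
    using trichotomy by (elim disjE exE) blast+
  then have "card N \<le> 2 * m - 3"
  proof cases
    case 1
    then show ?thesis using card_image[OF inj] card_S by simp
  next
    case (2 c)
    show ?thesis
    proof (rule pencil)
      \<comment> \<open>Parallel lines of slope \<open>c\<close> share the point at infinity with
        coefficients \<open>(c, 1, 0)\<close>.\<close>
      show "c *s u + v \<notin> p"
      proof
        assume "c *s u + v \<in> p"
        then have "c *s u + v - c *s u \<in> p"
          using p u by (intro vec.subspace_diff vec.subspace_scale) (auto simp: proj_points_def)
        then show False using v by simp
      qed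
      show "c *s u + v \<in> L" if "L \<in> N" for L
        using mem_iff[OF that, of c 1 0] 2 that by (simp add: l_def)
    qed
  next
    case (3 a y)
    show ?thesis
    proof (rule pencil)
      \<comment> \<open>This vector represents the common affine point
        \<open>(a, y)\<close>.\<close>
      show "y *s u + a *s v + w \<notin> p"
      proof
        assume "y *s u + a *s v + w \<in> p"
        then have "y *s u + a *s v + w \<in> L\<^sub>0" using L\<^sub>0'(2) by blast
        moreover have subL: "vec.subspace L\<^sub>0" using L\<^sub>0_M sub by (simp add: M_def)
        moreover have "y *s u + a *s v \<in> L\<^sub>0"
          using subL u v L\<^sub>0'(2) by (intro vec.subspace_add vec.subspace_scale) auto
        ultimately have "y *s u + a *s v + w - (y *s u + a *s v) \<in> L\<^sub>0"
          by (intro vec.subspace_diff)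
        then show False using w by simp
      qed
      show "y *s u + a *s v + w \<in> L" if "L \<in> N" for L
        using mem_iff[OF that, of y a 1] 3 that by (simp add: l_def algebra_simps)
    qed
  qed
  then show ?thesis using card_A assms(6) by simp
qed

end
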